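(* Let $k$, $r$ and $d$ be positive integers with $d \ge 2$, and let $G$ be a graph on $n = |V(G)|$ vertices with minimum degree at least $d$ and girth at least $2k+1$. Then $$\gamma^{t}_{(k,r)}(G) \leq \frac{2nr}{(d-1)^k} + n r e^{-r/4}.$$
   Context: For a graph $G$ and vertices $u,v$, $d(u,v)$ denotes the length of a shortest path between $u$ and $v$. For $v \in V(G)$, $N_k(v) = \{u \in V(G) : u \neq v,\ d(u,v) \le k\}$. A set $S \subseteq V(G)$ is a total $(k,r)$-dominating set of $G$ if for every vertex $u \in V(G)$, $|N_k(u) \cap S| \ge r$, i.e. every vertex is within distance $k$ of at least $r$ vertices of $S$ other than itself. The total $(k,r)$-domination number $\gamma^{t}_{(k,r)}(G)$ is the minimum cardinality of a total $(k,r)$-dominating set of $G$. The girth of $G$ is the length of a shortest cycle in $G$.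
   Formalization: The formal statement also assumes that G has at least one total (k,r)-dominating set, since otherwise the total (k,r)-domination number is a minimum over the empty set (e.g. the complete graph on 4 vertices with k = 1, r = 10). *)

theory Defs
  imports Complex_Main "HOL-Library.Extended_Nat" "Graph_Theory.Arc_Walk"
begin

text \<open>
  Finite simple graphs are the symmetric loop-free digraphs without parallel arcs of the locale
  \<open>graph\<close>: an edge $uv$ is the pair of arcs $(u,v)$ and $(v,u)$, so the degree of a vertex is its
  out-degree.
\<close>

definition min_degree :: "('a,'b) pre_digraph \<Rightarrow> enat" where
  "min_degree G = (INF v\<in>verts G. enat (out_degree G v))"

text \<open>The infimum is \<open>\<infinity>\<close> if \<open>u\<close> and \<open>v\<close> lie in different components.\<close>

definition graph_dist :: "('a,'b) pre_digraph \<Rightarrow> 'a \<Rightarrow> 'a \<Rightarrow> enat" where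
  "graph_dist G u v = (INF p\<in>{p. pre_digraph.apath G u p v}. enat (length p))"

text \<open>
  The bound \<open>3 \<le> length p\<close> excludes the closed walks $u,v,u$ along a single edge, which
  \<open>pre_digraph.cycle\<close> admits in a symmetric digraph. A forest has girth \<open>\<infinity>\<close>.
\<close>

definition girth :: "('a,'b) pre_digraph \<Rightarrow> enat" where
  "girth G = (INF p\<in>{p. pre_digraph.cycle G p \<and> 3 \<le> length p}. enat (length p))"

definition k_neighbours :: "('a,'b) pre_digraph \<Rightarrow> nat \<Rightarrow> 'a \<Rightarrow> 'a set" where
  "k_neighbours G k v = {u \<in> verts G. u \<noteq> v \<and> graph_dist G u v \<le> enat k}"

definition total_dominating :: "('a,'b) pre_digraph \<Rightarrow> nat \<Rightarrow> nat \<Rightarrow> 'a set \<Rightarrow> bool" where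
  "total_dominating G k r S \<longleftrightarrow>
     S \<subseteq> verts G \<and> (\<forall>u\<in>verts G. r \<le> card (k_neighbours G k u \<inter> S))"

text \<open>
  Meaningful only if \<open>G\<close> has a total $(k,r)$-dominating set, that is, if every vertex has at
  least \<open>r\<close> other vertices within distance \<open>k\<close>.
\<close>

definition total_domination_number :: "('a,'b) pre_digraph \<Rightarrow> nat \<Rightarrow> nat \<Rightarrow> nat" where
  "total_domination_number G k r = (LEAST m. \<exists>S. total_dominating G k r S \<and> card S = m)"

end

theory Submission
  imports Defs "HOL-Probability.Product_PMF"
begin

text \<open>
  Arrange the vertices in layers by their distance from a root. Two distinct neighbours of \<open>w\<close> that
  are at most as far from the root as \<open>w\<close> are joined through the root by a walk avoiding \<open>w\<close>,
  which closes up to a short cycle; hence up to depth \<open>k\<close> every vertex has at least $d-1$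
  neighbours in the next layer and no two vertices share one, so that every vertex has at least
  $(d-1)^k$ vertices within distance \<open>k\<close>.

  If $2r \ge (d-1)^k$, the bound is at least \<open>n\<close>. Otherwise choose every vertex independently with
  probability $p = 2r/(d-1)^k$. The expected number of chosen vertices within distance \<open>k\<close> of a
  given vertex is at least $2r$, so by Chernoff's bound it drops below \<open>r\<close> with probability at
  most $e^{-r/4}$; adding \<open>r\<close> vertices for each such vertex repairs the random set.
\<close>

section \<open>Random subsets with alteration\<close>

lemma exists_le_expectation_pmf:
  fixes X :: "'a \<Rightarrow> real"
  assumes "integrable (measure_pmf q) X"
  shows "\<exists>x\<in>set_pmf q. X x \<le> measure_pmf.expectation q X"
proof (rule ccontr)
  assume "\<not> ?thesis"
  then have "AE x in measure_pmf q. measure_pmf.expectation q X < X x"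
    by (auto simp: AE_measure_pmf_iff not_le)
  from measure_pmf.expectation_greater[OF assms this] show False by simp
qed

lemma expectation_power_binomial_pmf:
  fixes t :: real
  assumes "p \<in> {0..1}"
  shows "measure_pmf.expectation (binomial_pmf n p) (\<lambda>k. t ^ k) = (p * t + (1 - p)) ^ n"
  by (simp add: expectation_binomial_pmf'[OF assms] binomial_ring power_mult_distrib mult_ac)

lemma expectation_card_pmf:
  assumes "finite I"
  shows "measure_pmf.expectation q (\<lambda>x. real (card {i \<in> I. P i x}))
      = (\<Sum>i\<in>I. measure_pmf.prob q {x. P i x})"
proof -
  have "real (card {i \<in> I. P i x}) = (\<Sum>i\<in>I. indicator {x. P i x} x)" for x
    using assms by (simp add: indicator_def Int_def)
  then show ?thesis
    by (simp add: Bochner_Integration.integral_sum measure_pmf.emeasure_eq_measure)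
qed

lemma half_square_minus_one_le_mult_ln:
  fixes x :: real
  assumes "0 < x" "x \<le> 1"
  shows "(x\<^sup>2 - 1) / 2 \<le> x * ln x"
proof -
  have "- ln x \<le> (exp (- ln x) - inverse (exp (- ln x))) / 2"
    using assms by (intro real_le_x_sinh) simp
  also have "\<dots> = (1 / x - x) / 2"
    using assms by (simp add: exp_minus inverse_eq_divide)
  finally have "x * - ln x \<le> x * ((1 / x - x) / 2)"
    using assms by (intro mult_left_mono) auto
  also have "\<dots> = (1 - x\<^sup>2) / 2"
    using assms by (simp add: field_simps power2_eq_square)
  finally show ?thesis by (simp add: diff_divide_distrib)
qed

lemma binomial_pmf_Chernoff_lower_tail:
  fixes n :: nat and p \<delta> :: real
  assumes p: "p \<in> {0..1}" and \<delta>: "0 \<le> \<delta>" "\<delta> < 1"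
  defines "\<mu> \<equiv> real n * p"
  shows "measure_pmf.prob (binomial_pmf n p) {k. real k \<le> (1 - \<delta>) * \<mu>} \<le> exp (- \<delta>\<^sup>2 * \<mu> / 2)"
proof -
  let ?t = "1 - \<delta>"
  have \<mu>: "0 \<le> \<mu>" using p by (simp add: \<mu>_def)
  have "{k. real k \<le> ?t * \<mu>} \<subseteq> {k. ?t powr (?t * \<mu>) \<le> ?t ^ k}"
    using \<delta> by (auto simp: powr_realpow[symmetric] intro: powr_mono')
  then have "measure_pmf.prob (binomial_pmf n p) {k. real k \<le> ?t * \<mu>}
      \<le> measure_pmf.prob (binomial_pmf n p) {k. ?t powr (?t * \<mu>) \<le> ?t ^ k}"
    by (intro measure_pmf.finite_measure_mono) auto
  also have "\<dots> \<le> measure_pmf.expectation (binomial_pmf n p) (\<lambda>k. ?t ^ k) / ?t powr (?t * \<mu>)"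
    using integral_Markov_inequality_measure[of "measure_pmf (binomial_pmf n p)" "\<lambda>k. ?t ^ k" UNIV
        "?t powr (?t * \<mu>)"] p \<delta> by simp
  also have "\<dots> = (1 - \<delta> * p) ^ n / ?t powr (?t * \<mu>)"
    by (simp add: expectation_power_binomial_pmf[OF p] algebra_simps)
  also have "\<dots> \<le> exp (- \<delta> * p) ^ n / ?t powr (?t * \<mu>)"
    using exp_ge_add_one_self[of "- \<delta> * p"] p \<delta>
    by (intro divide_right_mono power_mono) (auto simp: mult_le_one)
  also have "\<dots> = exp (- (\<delta> + ?t * ln ?t) * \<mu>)"
    using \<delta> by (simp add: powr_def \<mu>_def algebra_simps flip: exp_of_nat_mult exp_diff)
  also have "\<dots> \<le> exp (- \<delta>\<^sup>2 * \<mu> / 2)"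
  proof -
    have "\<delta>\<^sup>2 / 2 \<le> \<delta> + ?t * ln ?t"
      using half_square_minus_one_le_mult_ln[of ?t] \<delta> by (simp add: power2_eq_square field_simps)
    from mult_right_mono[OF this \<mu>] show ?thesis by (simp add: algebra_simps)
  qed
  finally show ?thesis .
qed

definition random_subset_pmf :: "'a set \<Rightarrow> real \<Rightarrow> 'a set pmf" where
  "random_subset_pmf V p = map_pmf (\<lambda>f. {x \<in> V. f x}) (Pi_pmf V False (\<lambda>_. bernoulli_pmf p))"

lemma set_random_subset_pmf_subset: "set_pmf (random_subset_pmf V p) \<subseteq> Pow V"
  by (auto simp: random_subset_pmf_def)

lemma integrable_random_subset_pmf:
  fixes X :: "'a set \<Rightarrow> real"
  assumes "finite V"
  shows "integrable (measure_pmf (random_subset_pmf V p)) X"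
  using assms set_random_subset_pmf_subset[of V p]
  by (intro integrable_measure_pmf_finite) (meson finite_Pow_iff finite_subset)

lemma map_card_Int_random_subset_pmf:
  assumes "finite V" "N \<subseteq> V" "p \<in> {0..1}"
  shows "map_pmf (\<lambda>S. card (N \<inter> S)) (random_subset_pmf V p) = binomial_pmf (card N) p"
proof -
  have "binomial_pmf (card N) p
      = map_pmf (\<lambda>f. card {x \<in> N. f x}) (Pi_pmf N False (\<lambda>_. bernoulli_pmf p))"
    using assms by (intro binomial_pmf_altdef') (auto intro: finite_subset)
  also have "\<dots> = map_pmf (\<lambda>f. card {x \<in> N. f x}) (Pi_pmf V False (\<lambda>_. bernoulli_pmf p))"
    unfolding Pi_pmf_subset[OF \<open>finite V\<close> \<open>N \<subseteq> V\<close>] map_pmf_comp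
    by (intro map_pmf_cong refl arg_cong[where f = card]) auto
  also have "\<dots> = map_pmf (\<lambda>S. card (N \<inter> S)) (random_subset_pmf V p)"
    using \<open>N \<subseteq> V\<close> unfolding random_subset_pmf_def map_pmf_comp
    by (intro map_pmf_cong refl arg_cong[where f = card]) auto
  finally show ?thesis ..
qed

lemma expectation_card_random_subset_pmf:
  assumes "finite V" "p \<in> {0..1}"
  shows "measure_pmf.expectation (random_subset_pmf V p) (\<lambda>S. real (card S)) = real (card V) * p"
proof -
  let ?coins = "Pi_pmf V False (\<lambda>_. bernoulli_pmf p)"
  have "measure_pmf.prob ?coins {f. f v} = p" if "v \<in> V" for v
  proof -
    have "measure_pmf.prob ?coins {f. f v} = measure_pmf.prob (map_pmf (\<lambda>f. f v) ?coins) {True}"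
      by (simp add: vimage_def)
    also have "\<dots> = p"
      using assms that by (simp add: Pi_pmf_component measure_pmf_single)
    finally show ?thesis .
  qed
  then show ?thesis
    using \<open>finite V\<close> by (simp add: random_subset_pmf_def expectation_card_pmf)
qed

lemma prob_card_Int_random_subset_pmf_less_le:
  assumes "finite V" "N \<subseteq> V" and p: "p \<in> {0..1}" and r: "2 * real r \<le> p * real (card N)"
  shows "measure_pmf.prob (random_subset_pmf V p) {S. card (N \<inter> S) < r} \<le> exp (- real r / 4)"
proof -
  let ?\<mu> = "real (card N) * p"
  have "measure_pmf.prob (random_subset_pmf V p) {S. card (N \<inter> S) < r}
      = measure_pmf.prob (binomial_pmf (card N) p) {k. k < r}"
    using assms by (simp add: vimage_def flip: map_card_Int_random_subset_pmf[of V N])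
  also have "\<dots> \<le> measure_pmf.prob (binomial_pmf (card N) p) {k. real k \<le> (1 - 1 / 2) * ?\<mu>}"
    using r by (intro measure_pmf.finite_measure_mono) (auto simp: mult.commute)
  also have "\<dots> \<le> exp (- (1 / 2)\<^sup>2 * ?\<mu> / 2)"
    by (rule binomial_pmf_Chernoff_lower_tail[OF p]) auto
  also have "\<dots> \<le> exp (- real r / 4)"
    using r by (simp add: power2_eq_square mult.commute)
  finally show ?thesis .
qed

definition deficient :: "('i \<Rightarrow> 'a set) \<Rightarrow> nat \<Rightarrow> 'i set \<Rightarrow> 'a set \<Rightarrow> 'i set" where
  "deficient N r I S = {i \<in> I. card (N i \<inter> S) < r}"

lemma expectation_card_deficient_random_subset_pmf_le:
  assumes "finite V" "finite I" "\<And>i. i \<in> I \<Longrightarrow> N i \<subseteq> V" "p \<in> {0..1}"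
    and "\<And>i. i \<in> I \<Longrightarrow> 2 * real r \<le> p * real (card (N i))"
  shows "measure_pmf.expectation (random_subset_pmf V p) (\<lambda>S. real (card (deficient N r I S)))
      \<le> real (card I) * exp (- real r / 4)"
proof -
  have "measure_pmf.expectation (random_subset_pmf V p) (\<lambda>S. real (card (deficient N r I S)))
      = (\<Sum>i\<in>I. measure_pmf.prob (random_subset_pmf V p) {S. card (N i \<inter> S) < r})"
    unfolding deficient_def using \<open>finite I\<close> by (rule expectation_card_pmf)
  also have "\<dots> \<le> (\<Sum>i\<in>I. exp (- real r / 4))"
    using assms by (intro sum_mono prob_card_Int_random_subset_pmf_less_le)
  finally show ?thesis by simp
qed

lemma exists_multiple_transversal_card_le:
  assumes "finite I" and N: "\<And>i. i \<in> I \<Longrightarrow> finite (N i)" "\<And>i. i \<in> I \<Longrightarrow> r \<le> card (N i)"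
  shows "\<exists>T. T \<subseteq> S \<union> (\<Union>i\<in>I. N i) \<and> (\<forall>i\<in>I. r \<le> card (N i \<inter> T)) \<and>
           card T \<le> card S + r * card (deficient N r I S)"
proof -
  let ?D = "deficient N r I S"
  have "\<exists>X\<subseteq>N i. card X = r" if "i \<in> I" for i
    using N(2)[OF that] by (meson obtain_subset_with_card_n)
  then obtain X where X: "\<And>i. i \<in> I \<Longrightarrow> X i \<subseteq> N i" "\<And>i. i \<in> I \<Longrightarrow> card (X i) = r"
    by metis
  have D: "?D \<subseteq> I" by (auto simp: deficient_def)
  define T where "T = S \<union> (\<Union>i\<in>?D. X i)"
  have "r \<le> card (N i \<inter> T)" if i: "i \<in> I" for i
  proof (cases "i \<in> ?D")
    case True
    then have "X i \<subseteq> N i \<inter> T" using X(1)[OF i] by (auto simp: T_def)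
    then show ?thesis using X(2)[OF i] N(1)[OF i] by (metis card_mono finite_Int)
  next
    case False
    then have "r \<le> card (N i \<inter> S)" using i by (simp add: deficient_def)
    also have "\<dots> \<le> card (N i \<inter> T)"
      using N(1)[OF i] by (intro card_mono) (auto simp: T_def)
    finally show ?thesis .
  qed
  moreover have "card T \<le> card S + r * card ?D"
  proof -
    have "card (\<Union>i\<in>?D. X i) \<le> (\<Sum>i\<in>?D. card (X i))"
      using finite_subset[OF D \<open>finite I\<close>] by (rule card_UN_le)
    also have "\<dots> = r * card ?D"
      using X(2) D by (simp add: subset_iff)
    finally show ?thesis
      unfolding T_def by (meson add_left_mono card_Un_le order_trans)
  qed
  moreover have "T \<subseteq> S \<union> (\<Union>i\<in>I. N i)"
    using X(1) D unfolding T_def by blast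
  ultimately show ?thesis by blast
qed

lemma exists_small_multiple_transversal:
  assumes "finite V" "finite I" and N: "\<And>i. i \<in> I \<Longrightarrow> N i \<subseteq> V" and p: "p \<in> {0..1}"
    and r: "\<And>i. i \<in> I \<Longrightarrow> 2 * real r \<le> p * real (card (N i))"
  shows "\<exists>T\<subseteq>V. (\<forall>i\<in>I. r \<le> card (N i \<inter> T)) \<and>
           real (card T) \<le> real (card V) * p + real (card I) * real r * exp (- real r / 4)"
proof -
  let ?q = "random_subset_pmf V p"
  let ?cost = "\<lambda>S. real (card S) + real r * real (card (deficient N r I S))"
  note integrable = integrable_random_subset_pmf[OF \<open>finite V\<close>, of p]
  obtain S where S: "S \<in> set_pmf ?q" "?cost S \<le> measure_pmf.expectation ?q ?cost"
    using exists_le_expectation_pmf[OF integrable[of ?cost]] by blast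
  have r_le: "r \<le> card (N i)" if "i \<in> I" for i
  proof -
    have "p * real (card (N i)) \<le> real (card (N i))"
      using p by (simp add: mult_left_le_one_le)
    with r[OF that] show ?thesis by linarith
  qed
  obtain T where T: "T \<subseteq> S \<union> (\<Union>i\<in>I. N i)" "\<forall>i\<in>I. r \<le> card (N i \<inter> T)"
      "card T \<le> card S + r * card (deficient N r I S)"
    using exists_multiple_transversal_card_le[of I N r S] r_le N \<open>finite V\<close> \<open>finite I\<close>
    by (meson finite_subset)
  have "real (card T) \<le> real (card S + r * card (deficient N r I S))"
    using T(3) by (rule of_nat_mono)
  also have "\<dots> \<le> measure_pmf.expectation ?q ?cost"
    using S(2) by simp
  also have "\<dots> = real (card V) * p
      + real r * measure_pmf.expectation ?q (\<lambda>S. real (card (deficient N r I S)))"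
    by (simp add: integrable expectation_card_random_subset_pmf[OF \<open>finite V\<close> p])
  also have "\<dots> \<le> real (card V) * p + real r * (real (card I) * exp (- real r / 4))"
    using assms
    by (intro add_left_mono mult_left_mono expectation_card_deficient_random_subset_pmf_le) auto
  finally have "real (card T) \<le> real (card V) * p + real (card I) * real r * exp (- real r / 4)"
    by (simp add: mult_ac)
  moreover have "T \<subseteq> V"
    using T(1) N S(1) set_random_subset_pmf_subset[of V p] by blast
  ultimately show ?thesis using T(2) by blast
qed

section \<open>Distance layers and girth\<close>

lemma out_degree_ge_min_degree:
  assumes deg: "enat d \<le> min_degree G" and v: "v \<in> verts G"
  shows "d \<le> out_degree G v"
proof -
  have "enat d \<le> enat (out_degree G v)"
    using deg INF_lower[OF v] unfolding min_degree_def by (rule order_trans)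
  then show ?thesis by simp
qed

definition dist_layer :: "('a, 'b) pre_digraph \<Rightarrow> 'a \<Rightarrow> nat \<Rightarrow> 'a set" where
  "dist_layer G v i = {u \<in> verts G. graph_dist G u v = enat i}"

lemma dominatesE:
  assumes "u \<rightarrow>\<^bsub>G\<^esub> w"
  obtains e where "e \<in> arcs G" "tail G e = u" "head G e = w"
  using assms by (auto simp: arcs_ends_conv)

context wf_digraph
begin

lemma length_awalk_to_apath_le:
  assumes "awalk u p v"
  shows "length (awalk_to_apath p) \<le> length p"
proof -
  have "distinct (awalk_to_apath p)"
    using apath_awalk_to_apath[OF assms] unfolding apath_def
    by (blast intro: distinct_verts_imp_distinct)
  then have "length (awalk_to_apath p) = card (set (awalk_to_apath p))"
    by (simp add: distinct_card)
  also have "\<dots> \<le> card (set p)"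
    using awalk_to_apath_subset[OF assms] by (intro card_mono) auto
  also have "\<dots> \<le> length p" by (rule card_length)
  finally show ?thesis .
qed

lemma graph_dist_le_length:
  assumes "awalk u p v"
  shows "graph_dist G u v \<le> enat (length p)"
proof -
  have "graph_dist G u v \<le> enat (length (awalk_to_apath p))"
    unfolding graph_dist_def using apath_awalk_to_apath[OF assms] by (intro INF_lower) simp
  also have "\<dots> \<le> enat (length p)"
    using length_awalk_to_apath_le[OF assms] by simp
  finally show ?thesis .
qed

lemma graph_dist_attained:
  assumes "graph_dist G u v \<noteq> \<infinity>"
  obtains p where "apath u p v" "graph_dist G u v = enat (length p)"
proof -
  let ?lengths = "(\<lambda>p. enat (length p)) ` {p. apath u p v}"
  have "?lengths \<noteq> {}"
    using assms unfolding graph_dist_def by (metis Inf_empty top_enat_def)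
  then have "Inf ?lengths \<in> ?lengths"
    by (meson ex_in_conv wellorder_InfI)
  then show ?thesis using that unfolding graph_dist_def by auto
qed

lemma graph_dist_self: "v \<in> verts G \<Longrightarrow> graph_dist G v v = 0"
  using graph_dist_le_length[of v "[]" v] by (simp add: awalk_Nil_iff flip: zero_enat_def)

lemma graph_dist_dominates_le:
  assumes "u \<rightarrow>\<^bsub>G\<^esub> w"
  shows "graph_dist G u v \<le> eSuc (graph_dist G w v)"
proof (cases "graph_dist G w v = \<infinity>")
  case False
  then obtain p where p: "apath w p v" "graph_dist G w v = enat (length p)"
    by (rule graph_dist_attained)
  obtain e where e: "e \<in> arcs G" "tail G e = u" "head G e = w"
    using assms by (rule dominatesE)
  then have "awalk u (e # p) v"
    using p(1) by (simp add: awalk_Cons_iff apath_def)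
  from graph_dist_le_length[OF this] show ?thesis
    by (simp add: p(2) eSuc_enat)
qed simp

lemma dist_layer_subset_k_neighbours:
  assumes "v \<in> verts G" "k \<ge> 1"
  shows "dist_layer G v k \<subseteq> k_neighbours G k v"
  using graph_dist_self[OF \<open>v \<in> verts G\<close>] \<open>k \<ge> 1\<close>
  by (auto simp: dist_layer_def k_neighbours_def zero_enat_def)

lemma not_in_awalk_verts_if_length_le_graph_dist:
  assumes p: "awalk a p v" and le: "enat (length p) \<le> graph_dist G w v" and "a \<noteq> w"
  shows "w \<notin> set (awalk_verts a p)"
proof
  assume "w \<in> set (awalk_verts a p)"
  then obtain q s where qs: "p = q @ s" "awalk a q w" "awalk w s v"
    using awalk_decomp[OF p] by blast
  have "enat (length p) \<le> enat (length s)"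
    using le graph_dist_le_length[OF qs(3)] by (rule order_trans)
  then have "q = []" using qs(1) by simp
  with qs(2) \<open>a \<noteq> w\<close> show False by (simp add: awalk_Nil_iff)
qed

lemma girth_le_if_awalk_between_neighbours:
  assumes "w \<rightarrow>\<^bsub>G\<^esub> a" "b \<rightarrow>\<^bsub>G\<^esub> w" "a \<noteq> b"
    and p: "awalk a p b" and w: "w \<notin> set (awalk_verts a p)"
  shows "girth G \<le> enat (length p + 2)"
proof -
  obtain e where e: "e \<in> arcs G" "tail G e = w" "head G e = a"
    using \<open>w \<rightarrow>\<^bsub>G\<^esub> a\<close> by (rule dominatesE)
  obtain f where f: "f \<in> arcs G" "tail G f = b" "head G f = w"
    using \<open>b \<rightarrow>\<^bsub>G\<^esub> w\<close> by (rule dominatesE)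
  define t where "t = awalk_to_apath p"
  have t: "awalk a t b" "distinct (awalk_verts a t)"
    using apath_awalk_to_apath[OF p] by (auto simp: apath_def t_def)
  have "set (awalk_verts a t) \<subseteq> set (awalk_verts a p)"
    using awalk_to_apath_subset[OF p, folded t_def]
    by (auto simp: set_awalk_verts[OF p] set_awalk_verts[OF t(1)])
  with w have w_t: "w \<notin> set (awalk_verts a t)" by blast
  have tf: "awalk a (t @ [f]) w"
    using t(1) f by (auto simp: awalk_simps)
  then have "awalk w (e # t @ [f]) w"
    using e by (auto simp: awalk_Cons_iff)
  moreover have "distinct (tl (awalk_verts w (e # t @ [f])))"
    using awalk_verts_append[OF tf] e f t w_t by simp
  ultimately have "cycle (e # t @ [f])" by (auto simp: cycle_def)
  moreover have "t \<noteq> []"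
    using t(1) \<open>a \<noteq> b\<close> by (auto simp: awalk_Nil_iff)
  then have "3 \<le> length (e # t @ [f])" by (cases t) auto
  ultimately have "girth G \<le> enat (length (e # t @ [f]))"
    unfolding girth_def by (intro INF_lower) blast
  also have "\<dots> \<le> enat (length p + 2)"
    using length_awalk_to_apath_le[OF p] by (simp add: t_def)
  finally show ?thesis .
qed

end

lemma (in nomulti_digraph) card_dominated: "card {w. u \<rightarrow>\<^bsub>G\<^esub> w} = out_degree G u"
proof -
  have "{w. u \<rightarrow>\<^bsub>G\<^esub> w} = head G ` out_arcs G u"
    by (auto simp: arcs_ends_conv out_arcs_def)
  moreover have "inj_on (head G) (out_arcs G u)"
    by (auto intro!: inj_onI no_multi_arcs simp: arc_to_ends_def)
  ultimately show ?thesis by (simp add: card_image out_degree_def)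
qed

lemma (in sym_digraph) dominates_sym: "u \<rightarrow>\<^bsub>G\<^esub> w \<Longrightarrow> w \<rightarrow>\<^bsub>G\<^esub> u"
  using sym_arcs by (rule arcs_ends_symmetric)

lemma (in sym_digraph) awalk_reverse:
  assumes "awalk u p v"
  shows "\<exists>q. awalk v q u \<and> length q = length p \<and> set (awalk_verts v q) = set (awalk_verts u p)"
  using assms
proof (induction p arbitrary: u)
  case Nil
  then show ?case by (auto simp: awalk_Nil_iff intro!: exI[of _ "[]"])
next
  case (Cons e p)
  then have e: "e \<in> arcs G" "tail G e = u" and p: "awalk (head G e) p v"
    by (auto simp: awalk_Cons_iff)
  obtain q where q: "awalk v q (head G e)" "length q = length p"
    "set (awalk_verts v q) = set (awalk_verts (head G e) p)"
    using Cons.IH[OF p] by blast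
  have "head G e \<rightarrow>\<^bsub>G\<^esub> u"
    using e in_arcs_imp_in_arcs_ends dominates_sym by blast
  then obtain f where f: "f \<in> arcs G" "tail G f = head G e" "head G f = u"
    by (rule dominatesE)
  then have "awalk (head G e) [f] u"
    by (auto simp: awalk_simps)
  moreover have "head G e \<in> set (awalk_verts (head G e) p)"
    using p by (rule hd_in_awalk_verts)
  ultimately show ?case
    using q e f by (intro exI[of _ "q @ [f]"]) (auto simp: set_awalk_verts_append)
qed

context graph
begin

lemma neighbour_not_farther_unique:
  assumes a: "w \<rightarrow>\<^bsub>G\<^esub> a" "graph_dist G a v \<le> graph_dist G w v"
    and b: "w \<rightarrow>\<^bsub>G\<^esub> b" "graph_dist G b v \<le> graph_dist G w v"
    and girth: "graph_dist G a v + graph_dist G b v + 2 < girth G"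
  shows "a = b"
proof (rule ccontr)
  assume "a \<noteq> b"
  have neq: "a \<noteq> w" "b \<noteq> w"
    using a(1) b(1) adj_not_same by blast+
  have "graph_dist G a v \<noteq> \<infinity>" "graph_dist G b v \<noteq> \<infinity>"
    using girth by (intro notI; simp)+
  then obtain p q where p: "awalk a p v" "graph_dist G a v = enat (length p)"
    and q: "awalk b q v" "graph_dist G b v = enat (length q)"
    by (metis graph_dist_attained awalkI_apath)
  obtain q' where q': "awalk v q' b" "length q' = length q"
      "set (awalk_verts v q') = set (awalk_verts b q)"
    using awalk_reverse[OF q(1)] by blast
  have "awalk a (p @ q') b"
    using p(1) q'(1) by (rule awalk_appendI)
  moreover have "w \<notin> set (awalk_verts a (p @ q'))"
    using not_in_awalk_verts_if_length_le_graph_dist a(2) b(2) p q q' neq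
    by (simp add: set_awalk_verts_append)
  ultimately have "girth G \<le> enat (length (p @ q') + 2)"
    by (rule girth_le_if_awalk_between_neighbours[OF a(1) dominates_sym[OF b(1)] \<open>a \<noteq> b\<close>])
  with girth show False
    by (simp add: p(2) q(2) q'(2) numeral_eq_enat)
qed

lemma card_dominated_next_layer_ge:
  assumes u: "u \<in> dist_layer G v i" and girth: "enat (2 * i + 2) < girth G"
  shows "out_degree G u - 1 \<le> card {w \<in> dist_layer G v (Suc i). u \<rightarrow>\<^bsub>G\<^esub> w}"
    (is "_ \<le> card ?C")
proof -
  let ?B = "{w. u \<rightarrow>\<^bsub>G\<^esub> w} - ?C"
  have near: "graph_dist G w v \<le> enat i" if "w \<in> ?B" for w
  proof -
    have w: "u \<rightarrow>\<^bsub>G\<^esub> w" "graph_dist G w v \<noteq> enat (Suc i)"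
      using that adj_in_verts by (auto simp: dist_layer_def)
    have "graph_dist G w v \<le> enat (Suc i)"
      using graph_dist_dominates_le[OF dominates_sym[OF w(1)], of v] u
      by (simp add: dist_layer_def eSuc_enat)
    with w(2) show ?thesis by (cases "graph_dist G w v") auto
  qed
  have unique: "a = b" if a: "a \<in> ?B" and b: "b \<in> ?B" for a b
  proof (rule neighbour_not_farther_unique)
    show "graph_dist G a v \<le> graph_dist G u v" "graph_dist G b v \<le> graph_dist G u v"
      using near[OF a] near[OF b] u by (simp_all add: dist_layer_def)
    have "graph_dist G a v + graph_dist G b v + 2 \<le> enat i + enat i + 2"
      using near[OF a] near[OF b] by (intro add_mono) auto
    also have "\<dots> = enat (2 * i + 2)" by (simp add: numeral_eq_enat mult_2)
    finally show "graph_dist G a v + graph_dist G b v + 2 < girth G"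
      using girth by (rule le_less_trans)
  qed (use a b in auto)
  have fin: "finite {w. u \<rightarrow>\<^bsub>G\<^esub> w}"
    by (rule finite_subset[OF _ finite_verts]) (auto dest: adj_in_verts)
  have "card ?B \<le> Suc 0"
    using unique by (subst card_le_Suc0_iff_eq[OF finite_Diff[OF fin]]) blast
  moreover have "card ?B = out_degree G u - card ?C"
    using fin card_dominated[of u] by (subst card_Diff_subset) auto
  ultimately show ?thesis by simp
qed

lemma card_dist_layer_Suc_ge:
  assumes deg: "enat d \<le> min_degree G" and girth: "enat (2 * i + 2) < girth G"
  shows "(d - 1) * card (dist_layer G v i) \<le> card (dist_layer G v (Suc i))"
proof -
  let ?C = "\<lambda>u. {w \<in> dist_layer G v (Suc i). u \<rightarrow>\<^bsub>G\<^esub> w}"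
  have fin: "finite (dist_layer G v j)" for j
    by (simp add: dist_layer_def)
  have disjoint: "?C a \<inter> ?C b = {}"
    if "a \<in> dist_layer G v i" "b \<in> dist_layer G v i" "a \<noteq> b" for a b
  proof (rule ccontr)
    assume "?C a \<inter> ?C b \<noteq> {}"
    then obtain w where w: "w \<in> dist_layer G v (Suc i)" "a \<rightarrow>\<^bsub>G\<^esub> w" "b \<rightarrow>\<^bsub>G\<^esub> w" by blast
    have "graph_dist G a v + graph_dist G b v + 2 < girth G"
      using that(1,2) girth by (simp add: dist_layer_def numeral_eq_enat mult_2)
    then have "a = b"
      using w(1) that(1,2)
      by (intro neighbour_not_farther_unique[OF dominates_sym[OF w(2)] _ dominates_sym[OF w(3)], of v])
        (simp_all add: dist_layer_def)
    with \<open>a \<noteq> b\<close> show False ..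
  qed
  have "(d - 1) * card (dist_layer G v i) = (\<Sum>u\<in>dist_layer G v i. d - 1)"
    by simp
  also have "\<dots> \<le> (\<Sum>u\<in>dist_layer G v i. card (?C u))"
  proof (rule sum_mono)
    fix u assume u: "u \<in> dist_layer G v i"
    have "d - 1 \<le> out_degree G u - 1"
      using u out_degree_ge_min_degree[OF deg] by (intro diff_le_mono) (simp add: dist_layer_def)
    also have "\<dots> \<le> card (?C u)"
      using u girth by (rule card_dominated_next_layer_ge)
    finally show "d - 1 \<le> card (?C u)" .
  qed
  also have "\<dots> = card (\<Union>u\<in>dist_layer G v i. ?C u)"
    using fin disjoint by (intro card_UN_disjoint[symmetric]) auto
  also have "\<dots> \<le> card (dist_layer G v (Suc i))"
    using fin by (intro card_mono) auto
  finally show ?thesis .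
qed

lemma card_dist_layer_ge:
  assumes deg: "enat d \<le> min_degree G" and v: "v \<in> verts G"
    and girth: "enat (2 * i) < girth G"
  shows "(d - 1) ^ i \<le> card (dist_layer G v i)"
  using girth
proof (induction i)
  case 0
  have "v \<in> dist_layer G v 0"
    using v graph_dist_self by (simp add: dist_layer_def zero_enat_def)
  moreover have "finite (dist_layer G v 0)" by (simp add: dist_layer_def)
  ultimately show ?case by (auto simp: Suc_le_eq card_gt_0_iff)
next
  case (Suc i)
  have "enat (2 * i) < girth G"
    by (rule le_less_trans[OF _ Suc.prems]) simp
  then have "(d - 1) ^ Suc i \<le> (d - 1) * card (dist_layer G v i)"
    using Suc.IH by simp
  also have "\<dots> \<le> card (dist_layer G v (Suc i))"
    using Suc.prems by (intro card_dist_layer_Suc_ge[OF deg]) simp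
  finally show ?case .
qed

lemma card_k_neighbours_ge:
  assumes "enat d \<le> min_degree G" "v \<in> verts G" "enat (2 * k) < girth G" "k \<ge> 1"
  shows "(d - 1) ^ k \<le> card (k_neighbours G k v)"
proof -
  have "(d - 1) ^ k \<le> card (dist_layer G v k)"
    using assms by (intro card_dist_layer_ge)
  also have "\<dots> \<le> card (k_neighbours G k v)"
    using dist_layer_subset_k_neighbours[OF \<open>v \<in> verts G\<close> \<open>k \<ge> 1\<close>]
    by (rule card_mono[rotated]) (simp add: k_neighbours_def)
  finally show ?thesis .
qed

end

section \<open>The domination bound\<close>

lemma total_domination_number_le:
  "total_dominating G k r S \<Longrightarrow> total_domination_number G k r \<le> card S"
  unfolding total_domination_number_def by (rule Least_le) blast

lemma total_domination_number_le_if_card_k_neighbours_ge: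
  fixes D :: real
  assumes fin: "finite (verts G)" and "0 < D"
    and D: "\<And>v. v \<in> verts G \<Longrightarrow> D \<le> real (card (k_neighbours G k v))"
    and well_defined: "\<exists>S. total_dominating G k r S"
  defines "n \<equiv> card (verts G)"
  shows "real (total_domination_number G k r)
      \<le> 2 * real n * real r / D + real n * real r * exp (- real r / 4)"
proof (cases "D \<le> 2 * real r")
  case True
  obtain S where S: "total_dominating G k r S" using well_defined by blast
  then have "card S \<le> n"
    unfolding n_def total_dominating_def using fin by (intro card_mono) auto
  with total_domination_number_le[OF S] have "real (total_domination_number G k r) \<le> real n"
    by simp
  also have "\<dots> \<le> 2 * real n * real r / D"
    using mult_left_mono[OF True, of "real n"] \<open>0 < D\<close> by (simp add: field_simps)
  also have "\<dots> \<le> 2 * real n * real r / D + real n * real r * exp (- real r / 4)"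
    by simp
  finally show ?thesis .
next
  case False
  let ?p = "2 * real r / D"
  have "2 * real r \<le> ?p * real (card (k_neighbours G k v))" if "v \<in> verts G" for v
    using mult_left_mono[OF D[OF that], of ?p] \<open>0 < D\<close> by simp
  moreover have "k_neighbours G k v \<subseteq> verts G" for v by (auto simp: k_neighbours_def)
  moreover have "?p \<in> {0..1}" using False \<open>0 < D\<close> by simp
  ultimately obtain T where T: "T \<subseteq> verts G" "\<forall>v\<in>verts G. r \<le> card (k_neighbours G k v \<inter> T)"
    and card_T: "real (card T) \<le> real n * ?p + real n * real r * exp (- real r / 4)"
    unfolding n_def
    using exists_small_multiple_transversal[OF fin fin, of "k_neighbours G k" ?p r] by blast
  have "total_domination_number G k r \<le> card T"
    using T by (intro total_domination_number_le) (simp add: total_dominating_def)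
  with card_T show ?thesis by (simp add: mult_ac)
qed

theorem theorem8:
  fixes G :: "('a,'b) pre_digraph" and k r d n :: nat
  assumes "graph G"
    and "n = card (verts G)"
    and "k \<ge> 1" and "r \<ge> 1" and "d \<ge> 2"
    and "min_degree G \<ge> enat d"
    and "girth G \<ge> enat (2 * k + 1)"
    and well_defined: "\<exists>S. total_dominating G k r S"
  shows "real (total_domination_number G k r)
           \<le> 2 * real n * real r / (real d - 1) ^ k + real n * real r * exp (- real r / 4)"
proof -
  interpret graph G by fact
  have "enat (2 * k) < girth G"
    by (rule less_le_trans[OF _ \<open>enat (2 * k + 1) \<le> girth G\<close>]) simp
  then have card_ge: "(d - 1) ^ k \<le> card (k_neighbours G k v)" if "v \<in> verts G" for v
    using that assms by (intro card_k_neighbours_ge)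
  have "(real d - 1) ^ k \<le> real (card (k_neighbours G k v))" if "v \<in> verts G" for v
  proof -
    have "(real d - 1) ^ k = real ((d - 1) ^ k)" using \<open>d \<ge> 2\<close> by simp
    also have "\<dots> \<le> real (card (k_neighbours G k v))"
      using card_ge[OF that] by (rule of_nat_mono)
    finally show ?thesis .
  qed
  moreover have "0 < (real d - 1) ^ k" using \<open>d \<ge> 2\<close> by simp
  ultimately show ?thesis
    unfolding \<open>n = card (verts G)\<close> using well_defined
    by (intro total_domination_number_le_if_card_k_neighbours_ge) auto
qed

end
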